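(* Let $k$ be a positive integer. If there exists an RSD set of integers of cardinality $k$, then for every integer $n \geq k$ there exist infinitely many RSD sets of integers of cardinality $k^n + 1$; that is, $H^*(k^n + 1) = \infty$ for all integers $n \geq k$.
   Context: For a nonempty finite set $A \subseteq \mathbb{Z}$, define $A - A := \{a - b : a, b \in A\}$ and the restricted sumset $A \dotplus A := \{a + b : a, b \in A,\ a \neq b\}$. The set $A$ is called a restricted-sum-dominant (RSD) set if $|A \dotplus A| > |A - A|$. For an integer $c$ and a set $A$, let $c + A := \{c + a : a \in A\}$ and $c \cdot A := \{ca : a \in A\}$. Two finite sets $A, B \subseteq \mathbb{Z}$ are affinely equivalent if there exist integers $x$ and $r \neq 0$ such that $A = x + r \cdot B$ or $B = x + r \cdot A$; otherwise they are affinely inequivalent. For a positive integer $k$, $H^*(k)$ denotes the number (possibly infinite) of pairwise affinely inequivalent RSD sets of integers of cardinality $k$. *)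

theory Defs
  imports Main "HOL-Library.Extended_Nat"
begin

definition difference_set :: "int set \<Rightarrow> int set" where
  "difference_set A = {a - b | a b. a \<in> A \<and> b \<in> A}"

definition restricted_sumset :: "int set \<Rightarrow> int set" where
  "restricted_sumset A = {a + b | a b. a \<in> A \<and> b \<in> A \<and> a \<noteq> b}"

definition RSD :: "int set \<Rightarrow> bool" where
  "RSD A \<longleftrightarrow> finite A \<and> A \<noteq> {} \<and> card (restricted_sumset A) > card (difference_set A)"

definition RSD_sets :: "nat \<Rightarrow> int set set" where
  "RSD_sets k = {A. RSD A \<and> card A = k}"

definition affinely_equivalent :: "int set \<Rightarrow> int set \<Rightarrow> bool" where
  "affinely_equivalent A B \<longleftrightarrow>
     (\<exists>x r. r \<noteq> 0 \<and> (A = (+) x ` (*) r ` B \<or> B = (+) x ` (*) r ` A))"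

text \<open>
  The supremum of the sizes of the finite families of pairwise affinely inequivalent RSD sets
  of cardinality \<open>k\<close>. It is formed with a supremum, not as a number of classes, because
  \<^const>\<open>affinely_equivalent\<close> is not transitive: \<open>2 \<cdot> A\<close> and \<open>3 \<cdot> A\<close> are both equivalent to \<open>A\<close>,
  but in general not to each other.
\<close>
definition H_star :: "nat \<Rightarrow> enat" where
  "H_star k = Sup {enat (card F) | F.
     finite F \<and> F \<subseteq> RSD_sets k \<and> pairwise (\<lambda>A B. \<not> affinely_equivalent A B) F}"

text \<open>
  The classes of RSD sets of cardinality \<open>k\<close> under the equivalence relation generated by
  \<^const>\<open>affinely_equivalent\<close>. Representatives of distinct classes are affinely inequivalent,
  so infinitely many classes force \<open>H_star k = \<infinity>\<close>. Counting classes is the stricter count: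
  dilates \<open>p \<cdot> A\<close> of a single set \<open>A\<close> by different primes can be affinely inequivalent,
  yet they all lie in one class.
\<close>
definition RSD_classes :: "nat \<Rightarrow> int set set set" where
  "RSD_classes k = RSD_sets k // {(A, B). equivclp affinely_equivalent A B}"

end

theory Submission
  imports Defs Complex_Main "HOL-Library.Set_Algebras"
begin

text \<open>
  Let \<open>A\<close> be an RSD set with \<open>k\<close> elements, \<open>d\<close> differences, \<open>\<sigma>\<close> sums and \<open>u\<close> sums that
  arise only as doubles, so that \<open>\<sigma> \<ge> d + 1 + u\<close>. The set \<open>A\<^sup>n\<close>, embedded into \<open>\<int>\<close> by digit
  expansion in a large base, has \<open>d\<^sup>n\<close> differences and \<open>\<sigma>\<^sup>n - u\<^sup>n\<close> restricted sums. A far away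
  point \<open>t\<close> adds \<open>k\<^sup>n\<close> restricted sums and at most \<open>2k\<^sup>n\<close> differences, which the surplus
  \<open>\<sigma>\<^sup>n - u\<^sup>n - d\<^sup>n \<ge> (d + 1)\<^sup>n - d\<^sup>n \<ge> n d\<^sup>n\<^sup>-\<^sup>1 > k\<^sup>n\<close> absorbs, as \<open>n \<ge> k\<close> and \<open>d > k\<close>. The finite set of
  ratios of differences of a set is an affine invariant, and infinitely many ratios occur
  as \<open>t\<close> varies.
\<close>

section \<open>Sums, differences and doubles of a finite set\<close>

lemma finite_difference_set: "finite A \<Longrightarrow> finite (difference_set A)"
proof -
  assume "finite A"
  moreover have "difference_set A = (\<lambda>(a, b). a - b) ` (A \<times> A)"
    by (auto simp: difference_set_def)
  ultimately show ?thesis by simp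
qed

lemma restricted_sumset_subset: "restricted_sumset A \<subseteq> A + A"
  by (auto simp: restricted_sumset_def set_plus_def)

definition exclusive_doubles :: "int set \<Rightarrow> int set" where
  "exclusive_doubles A = (A + A) - restricted_sumset A"

lemma card_sumset_eq:
  assumes "finite A"
  shows "card (A + A) = card (restricted_sumset A) + card (exclusive_doubles A)"
proof -
  have fin: "finite (A + A)" using assms by (rule finite_set_plus[OF _ assms])
  have "A + A = restricted_sumset A \<union> exclusive_doubles A"
    using restricted_sumset_subset by (auto simp: exclusive_doubles_def)
  moreover have "finite (restricted_sumset A)" "finite (exclusive_doubles A)"
    using fin finite_subset[OF restricted_sumset_subset] by (auto simp: exclusive_doubles_def)
  moreover have "restricted_sumset A \<inter> exclusive_doubles A = {}"
    by (auto simp: exclusive_doubles_def)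
  ultimately show ?thesis by (metis card_Un_disjoint)
qed

section \<open>Products and powers embedded by digit expansion\<close>

text \<open>The low digit \<open>a\<close> may be negative and the high digit \<open>b\<close> is
  unrestricted. The map is additive for every base \<open>M\<close>; only injectivity needs
  \<open>M\<close> to be large.\<close>

definition digits :: "int \<Rightarrow> int \<times> int \<Rightarrow> int" where
  "digits M = (\<lambda>(a, b). a + M * b)"

text \<open>If two values agree, their low digits differ by a multiple of \<open>M\<close>, yet by
  at most \<open>2 * N\<close>, hence not at all.\<close>

lemma inj_on_digits:
  assumes "2 * N < M"
  shows "inj_on (digits M) ({-N..N} \<times> UNIV)"
proof (rule inj_onI, clarsimp simp: digits_def)
  fix a b a' b' :: int
  assume bounds: "- N \<le> a" "a \<le> N" "- N \<le> a'" "a' \<le> N" and eq: "a + M * b = a' + M * b'"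
  have "a - a' = M * (b' - b)" using eq by (simp add: algebra_simps)
  then have "M dvd a - a'" by simp
  moreover have "\<bar>a - a'\<bar> < M" using bounds assms by linarith
  ultimately have "a = a'" using dvd_imp_le_int[of "a - a'" M] by auto
  then show "a = a' \<and> b = b'" using eq bounds assms by auto
qed

lemma sumset_digits: "digits M ` (A \<times> B) + digits M ` (A \<times> B) = digits M ` ((A + A) \<times> (B + B))"
proof (intro equalityI subsetI)
  fix z assume "z \<in> digits M ` (A \<times> B) + digits M ` (A \<times> B)"
  then obtain a b a' b' where "a \<in> A" "a' \<in> A" "b \<in> B" "b' \<in> B"
    and "z = digits M (a + a', b + b')"
    by (auto simp: set_plus_def digits_def algebra_simps)
  then show "z \<in> digits M ` ((A + A) \<times> (B + B))" by (auto simp: set_plus_def)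
next
  fix z assume "z \<in> digits M ` ((A + A) \<times> (B + B))"
  then obtain a b a' b' where mem: "a \<in> A" "a' \<in> A" "b \<in> B" "b' \<in> B"
    and "z = digits M (a + a', b + b')"
    by (auto simp: set_plus_def)
  then have "z = digits M (a, b) + digits M (a', b')" by (simp add: digits_def algebra_simps)
  then show "z \<in> digits M ` (A \<times> B) + digits M ` (A \<times> B)" using mem by blast
qed

lemma difference_set_digits:
  "difference_set (digits M ` (A \<times> B)) = digits M ` (difference_set A \<times> difference_set B)"
proof (intro equalityI subsetI)
  fix z assume "z \<in> difference_set (digits M ` (A \<times> B))"
  then obtain a b a' b' where "a \<in> A" "a' \<in> A" "b \<in> B" "b' \<in> B"
    and "z = digits M (a - a', b - b')"
    by (auto simp: difference_set_def digits_def algebra_simps)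
  then show "z \<in> digits M ` (difference_set A \<times> difference_set B)"
    by (auto simp: difference_set_def)
next
  fix z assume "z \<in> digits M ` (difference_set A \<times> difference_set B)"
  then obtain a b a' b' where mem: "a \<in> A" "a' \<in> A" "b \<in> B" "b' \<in> B"
    and "z = digits M (a - a', b - b')"
    by (auto simp: difference_set_def)
  then have "z = digits M (a, b) - digits M (a', b')" by (simp add: digits_def algebra_simps)
  then show "z \<in> difference_set (digits M ` (A \<times> B))"
    unfolding difference_set_def using mem by blast
qed

text \<open>A sum of pairs is a restricted sum as soon as one coordinate is, so the complements
  multiply. Injectivity on \<open>A + A\<close> recovers the coordinates of a sum; on
  \<open>A\<close> it keeps distinct summands distinct.\<close>

lemma exclusive_doubles_digits:
  assumes inj: "inj_on (digits M) (S \<times> UNIV)" and A: "A \<subseteq> S" and AA: "A + A \<subseteq> S"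
  shows "exclusive_doubles (digits M ` (A \<times> B)) =
    digits M ` (exclusive_doubles A \<times> exclusive_doubles B)"
proof -
  let ?C = "digits M ` (A \<times> B)"
  have restricted: "digits M (p, q) \<in> restricted_sumset ?C \<longleftrightarrow>
      p \<in> restricted_sumset A \<or> q \<in> restricted_sumset B" (is "?L \<longleftrightarrow> ?R")
    if p: "p \<in> A + A" and q: "q \<in> B + B" for p q
  proof
    assume ?L
    then obtain a b a' b' where mem: "a \<in> A" "a' \<in> A" "b \<in> B" "b' \<in> B"
      and ne: "digits M (a, b) \<noteq> digits M (a', b')"
      and "digits M (p, q) = digits M (a, b) + digits M (a', b')"
      unfolding restricted_sumset_def by blast
    then have "digits M (p, q) = digits M (a + a', b + b')"
      by (simp add: digits_def algebra_simps)
    moreover have "p \<in> S" "a + a' \<in> S" using p mem AA by auto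
    ultimately have "p = a + a'" "q = b + b'" using inj_onD[OF inj, of "(p, q)" "(a + a', b + b')"]
      by auto
    moreover have "a \<noteq> a' \<or> b \<noteq> b'" using ne by auto
    ultimately show ?R using mem unfolding restricted_sumset_def by blast
  next
    assume ?R
    then obtain a b a' b' where mem: "a \<in> A" "a' \<in> A" "b \<in> B" "b' \<in> B"
      and pq: "p = a + a'" "q = b + b'" and ne: "a \<noteq> a' \<or> b \<noteq> b'"
      using p q unfolding restricted_sumset_def set_plus_def by blast
    have "digits M (a, b) \<noteq> digits M (a', b')"
      using inj_onD[OF inj, of "(a, b)" "(a', b')"] mem A ne by auto
    moreover have "digits M (p, q) = digits M (a, b) + digits M (a', b')"
      using pq by (simp add: digits_def algebra_simps)
    ultimately show ?L using mem unfolding restricted_sumset_def by blast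
  qed
  show ?thesis
  proof (intro equalityI subsetI)
    fix z assume "z \<in> exclusive_doubles ?C"
    then have "z \<in> digits M ` ((A + A) \<times> (B + B))" "z \<notin> restricted_sumset ?C"
      unfolding exclusive_doubles_def sumset_digits by auto
    then show "z \<in> digits M ` (exclusive_doubles A \<times> exclusive_doubles B)"
      using restricted unfolding exclusive_doubles_def by blast
  next
    fix z assume "z \<in> digits M ` (exclusive_doubles A \<times> exclusive_doubles B)"
    then show "z \<in> exclusive_doubles ?C"
      unfolding exclusive_doubles_def sumset_digits using restricted by blast
  qed
qed

text \<open>Restricted sumsets are not multiplicative under products, so the full sumset and the
  exclusive doubles are tracked instead; their cardinalities differ by the number of restricted
  sums.\<close>

lemma ex_power_set:
  assumes "finite A"
  shows "\<exists>B. finite B \<and> card B = card A ^ n \<and> card (difference_set B) = card (difference_set A) ^ n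
    \<and> card (B + B) = card (A + A) ^ n \<and> card (exclusive_doubles B) = card (exclusive_doubles A) ^ n"
proof (induction n)
  case 0
  have "difference_set {0} = {0}" "exclusive_doubles {0} = {0}" "{0} + {0} = {0::int}"
    by (auto simp: difference_set_def exclusive_doubles_def restricted_sumset_def set_plus_def)
  then show ?case by (intro exI[of _ "{0}"]) (simp del: set_plus_image)
next
  case (Suc n)
  then obtain B where B: "finite B" "card B = card A ^ n"
    "card (difference_set B) = card (difference_set A) ^ n"
    "card (B + B) = card (A + A) ^ n" "card (exclusive_doubles B) = card (exclusive_doubles A) ^ n"
    by blast
  have "finite (A \<union> (A + A) \<union> difference_set A)"
    using assms finite_difference_set finite_set_plus by blast
  \<comment> \<open>The factor \<open>A\<close> supplies the low digits, so the base depends on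
    \<open>A\<close> alone and \<open>B\<close> needs no bound.\<close>
  then obtain N where "abs ` (A \<union> (A + A) \<union> difference_set A) \<subseteq> {..N}"
    using finite_int_iff_bounded_le by blast
  then have N: "A \<subseteq> {-N..N}" "A + A \<subseteq> {-N..N}" "difference_set A \<subseteq> {-N..N}"
    by (auto simp: image_subset_iff abs_le_iff minus_le_iff)
  define M where "M = 2 * N + 1"
  have inj: "inj_on (digits M) ({-N..N} \<times> UNIV)" by (rule inj_on_digits) (simp add: M_def)
  have card: "card (digits M ` (X \<times> Y)) = card X * card Y" if "X \<subseteq> {-N..N}" for X Y
  proof -
    have "inj_on (digits M) (X \<times> Y)" by (rule inj_on_subset[OF inj]) (use that in auto)
    then show ?thesis by (simp add: card_image card_cartesian_product)
  qed
  have "exclusive_doubles A \<subseteq> {-N..N}" using N by (auto simp: exclusive_doubles_def)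
  then show ?case
    by (intro exI[of _ "digits M ` (A \<times> B)"])
      (use assms B N in \<open>simp add: card sumset_digits difference_set_digits
        exclusive_doubles_digits[OF inj]\<close>)
qed

section \<open>Adjoining a far point\<close>

text \<open>Every \<open>t + b\<close> exceeds \<open>2 * N\<close>, which no sum of two elements of
  \<open>B\<close> does; so all the sums with \<open>t\<close> are new.\<close>

lemma card_restricted_sumset_insert:
  assumes fin: "finite B" and bound: "abs ` B \<subseteq> {..N}" and t: "3 * N < t"
  shows "card (restricted_sumset (insert t B)) = card (restricted_sumset B) + card B"
proof -
  have B: "\<bar>b\<bar> \<le> N" if "b \<in> B" for b using bound that by auto
  have tB: "t \<notin> B" using B[of t] t by auto
  have "restricted_sumset (insert t B) = restricted_sumset B \<union> (+) t ` B"
    using tB by (auto simp: restricted_sumset_def image_iff)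
  moreover have "restricted_sumset B \<inter> (+) t ` B = {}"
  proof -
    have "a + b \<noteq> t + c" if "a \<in> B" "b \<in> B" "c \<in> B" for a b c
      using that[THEN B] t by linarith
    then show ?thesis by (fastforce simp: restricted_sumset_def)
  qed
  moreover have "finite (restricted_sumset B)"
    using finite_subset[OF restricted_sumset_subset] finite_set_plus fin by blast
  ultimately show ?thesis using fin by (simp add: card_Un_disjoint card_image)
qed

text \<open>The only further difference is \<open>t - t = 0\<close>, which already occurs because
  \<open>B\<close> is nonempty.\<close>

lemma card_difference_set_insert_le:
  assumes fin: "finite B" and ne: "B \<noteq> {}"
  shows "card (difference_set (insert t B)) \<le> card (difference_set B) + 2 * card B"
proof -
  have "difference_set (insert t B) \<subseteq>
      difference_set B \<union> ((\<lambda>b. t - b) ` B \<union> (\<lambda>b. b - t) ` B)"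
    using ne by (auto simp: difference_set_def)
  then have "card (difference_set (insert t B)) \<le>
      card (difference_set B \<union> ((\<lambda>b. t - b) ` B \<union> (\<lambda>b. b - t) ` B))"
    by (intro card_mono) (use fin finite_difference_set in auto)
  also have "\<dots> \<le> card (difference_set B) + (card ((\<lambda>b. t - b) ` B) + card ((\<lambda>b. b - t) ` B))"
    by (intro order_trans[OF card_Un_le] add_left_mono card_Un_le)
  also have "\<dots> \<le> card (difference_set B) + 2 * card B"
    using card_image_le[OF fin, of "\<lambda>b. t - b"] card_image_le[OF fin, of "\<lambda>b. b - t"] by simp
  finally show ?thesis .
qed

section \<open>Power inequalities for the surplus\<close>

lemma power_add_ge:
  fixes a b :: nat
  assumes "n > 0"
  shows "a ^ n + b ^ n \<le> (a + b) ^ n"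
  using assms
proof (induction n rule: nat_induct_non_zero)
  case (Suc n)
  have "a ^ Suc n + b ^ Suc n \<le> (a + b) * (a ^ n + b ^ n)" by (simp add: algebra_simps)
  also have "\<dots> \<le> (a + b) * (a + b) ^ n" using Suc by simp
  finally show ?case by simp
qed simp

text \<open>These are the two leading terms of the binomial expansion.\<close>

lemma power_Suc_ge:
  fixes d :: nat
  shows "d ^ Suc n + Suc n * d ^ n \<le> (d + 1) ^ Suc n"
proof (induction n)
  case (Suc n)
  have "d ^ Suc (Suc n) + Suc (Suc n) * d ^ Suc n \<le> (d + 1) * (d ^ Suc n + Suc n * d ^ n)"
    by (simp add: algebra_simps)
  also have "\<dots> \<le> (d + 1) * (d + 1) ^ Suc n" using Suc by (intro mult_left_mono) auto
  finally show ?case by simp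
qed simp

text \<open>The single \<open>k ^ n\<close> is the net cost of a far point: up to
  \<open>2 * k ^ n\<close> new differences against \<open>k ^ n\<close> new restricted sums.\<close>

lemma power_surplus:
  fixes d k u \<sigma> n :: nat
  assumes "2 \<le> k" "k < d" "k \<le> n" "d + 1 + u \<le> \<sigma>"
  shows "u ^ n + d ^ n + k ^ n < \<sigma> ^ n"
proof -
  \<comment> \<open>Here \<open>n\<close> is at least 2, and \<open>m > 0\<close> is what makes
    \<open>k ^ m < d ^ m\<close> strict.\<close>
  obtain m where m: "n = Suc m" "m > 0" using assms by (cases n) auto
  have "k ^ n \<le> n * k ^ m" using mult_right_mono[OF \<open>k \<le> n\<close>] m by simp
  also have "\<dots> < n * d ^ m" using assms m by (intro mult_strict_left_mono power_strict_mono) auto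
  finally have "u ^ n + d ^ n + k ^ n < u ^ n + (d + 1) ^ n"
    using power_Suc_ge[of d m] unfolding m by linarith
  also have "\<dots> \<le> (d + 1 + u) ^ n" using power_add_ge[of n "d + 1" u] m by simp
  also have "\<dots> \<le> \<sigma> ^ n" using assms by (intro power_mono) auto
  finally show ?thesis .
qed

section \<open>Construction of the larger RSD sets\<close>

lemma RSD_card_ge_2:
  assumes "RSD A"
  shows "2 \<le> card A"
proof (rule ccontr)
  assume "\<not> 2 \<le> card A"
  then have "card A \<le> Suc 0" by simp
  then have "restricted_sumset A = {}"
    using assms by (auto simp: RSD_def restricted_sumset_def card_le_Suc0_iff_eq)
  then show False using assms by (simp add: RSD_def)
qed

text \<open>Subtracting the minimum from each element gives \<open>card A\<close> nonnegative
  differences, and there is also a negative one.\<close>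

lemma card_less_difference_set:
  assumes fin: "finite A" and card: "2 \<le> card A"
  shows "card A < card (difference_set A)"
proof -
  let ?m = "Min A"
  have ne: "A \<noteq> {}" using card by auto
  have m: "?m \<in> A" "\<And>a. a \<in> A \<Longrightarrow> ?m \<le> a" using fin ne by auto
  have "\<not> A \<subseteq> {?m}" using card card_mono[of "{?m}" A] by auto
  then obtain a where a: "a \<in> A" "?m < a" using m by force
  then have "?m - a \<notin> (\<lambda>a. a - ?m) ` A" using m(2) by force
  then have "card (insert (?m - a) ((\<lambda>a. a - ?m) ` A)) = Suc (card A)"
    using fin by (simp add: card_image inj_on_def)
  moreover have "insert (?m - a) ((\<lambda>a. a - ?m) ` A) \<subseteq> difference_set A"
    using m a by (auto simp: difference_set_def)
  ultimately show ?thesis using card_mono[OF finite_difference_set[OF fin]]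
    by (metis Suc_le_eq)
qed

text \<open>\<open>B\<close> stays fixed while \<open>t\<close> varies; this one-parameter family is
  what later yields infinitely many classes.\<close>

lemma ex_RSD_insert:
  assumes "RSD A" "card A \<le> n"
  shows "\<exists>B N. finite B \<and> 2 \<le> card B \<and> (\<forall>t>N. insert t B \<in> RSD_sets (card A ^ n + 1))"
proof -
  have fin: "finite A" using assms by (simp add: RSD_def)
  have k: "2 \<le> card A" using assms(1) by (rule RSD_card_ge_2)
  obtain B where B: "finite B" "card B = card A ^ n"
    "card (difference_set B) = card (difference_set A) ^ n"
    "card (B + B) = card (A + A) ^ n" "card (exclusive_doubles B) = card (exclusive_doubles A) ^ n"
    using ex_power_set[OF fin] by blast
  obtain N where N: "abs ` B \<subseteq> {..N}" using B(1) finite_int_iff_bounded_le by blast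
  have "card A ^ 1 \<le> card A ^ n" using k assms(2) by (intro power_increasing) auto
  then have B2: "2 \<le> card B" using B(2) k by simp
  then have ne: "B \<noteq> {}" by auto
  have "card (difference_set A) + 1 + card (exclusive_doubles A) \<le> card (A + A)"
    using assms(1) card_sumset_eq[OF fin] by (simp add: RSD_def)
  from power_surplus[OF k card_less_difference_set[OF fin k] assms(2) this]
  have surplus: "card (difference_set B) + card B < card (restricted_sumset B)"
    using B card_sumset_eq[OF B(1)] by simp
  have "insert t B \<in> RSD_sets (card A ^ n + 1)" if t: "3 * N < t" for t
  proof -
    have "t \<notin> B"
    proof
      assume "t \<in> B"
      then have "\<bar>t\<bar> \<le> N" using N by auto
      then show False using t by linarith
    qed
    moreover have "card (difference_set (insert t B)) < card (restricted_sumset (insert t B))"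
      using card_restricted_sumset_insert[OF B(1) N t] surplus
        card_difference_set_insert_le[OF B(1) ne, of t] by simp
    ultimately show ?thesis using B by (simp add: RSD_sets_def RSD_def)
  qed
  then show ?thesis using B(1) B2 by blast
qed

section \<open>An affine invariant\<close>

text \<open>Since \<open>x / 0 = 0\<close>, pairs with \<open>c = d\<close> contribute only the ratio \<open>0\<close>.\<close>

definition difference_ratios :: "int set \<Rightarrow> real set" where
  "difference_ratios A = {of_int (a - b) / of_int (c - d) | a b c d. a \<in> A \<and> b \<in> A \<and> c \<in> A \<and> d \<in> A}"

lemma finite_difference_ratios:
  assumes "finite A"
  shows "finite (difference_ratios A)"
proof -
  have "difference_ratios A = (\<lambda>(a, b, c, d). of_int (a - b) / of_int (c - d)) ` (A \<times> A \<times> A \<times> A)"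
    by (force simp: difference_ratios_def)
  then show ?thesis using assms by simp
qed

text \<open>The translation \<open>x\<close> cancels in each difference and the factor
  \<open>r\<close> in each quotient; for a zero denominator both quotients are 0.\<close>

lemma difference_ratios_affine:
  assumes "r \<noteq> 0"
  shows "difference_ratios ((+) x ` (*) r ` A) = difference_ratios A"
proof -
  have eq: "real_of_int ((x + r * a) - (x + r * b)) / of_int ((x + r * c) - (x + r * d)) =
      of_int (a - b) / of_int (c - d)" for a b c d
  proof -
    have "(x + r * a) - (x + r * b) = r * (a - b)" "(x + r * c) - (x + r * d) = r * (c - d)"
      by (simp_all add: algebra_simps)
    then show ?thesis using assms by (simp only: of_int_mult) simp
  qed
  show ?thesis
  proof (intro equalityI subsetI)
    fix q assume "q \<in> difference_ratios ((+) x ` (*) r ` A)"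
    then obtain a b c d where "a \<in> A" "b \<in> A" "c \<in> A" "d \<in> A"
      and "q = of_int ((x + r * a) - (x + r * b)) / of_int ((x + r * c) - (x + r * d))"
      unfolding difference_ratios_def by blast
    then show "q \<in> difference_ratios A" unfolding eq difference_ratios_def by blast
  next
    fix q assume "q \<in> difference_ratios A"
    then obtain a b c d where "a \<in> A" "b \<in> A" "c \<in> A" "d \<in> A"
      and "q = of_int ((x + r * a) - (x + r * b)) / of_int ((x + r * c) - (x + r * d))"
      unfolding difference_ratios_def eq by blast
    then show "q \<in> difference_ratios ((+) x ` (*) r ` A)"
      unfolding difference_ratios_def by blast
  qed
qed

text \<open>A chain of affine equivalences, traversed in either direction, preserves the invariant
  at each link.\<close>

lemma difference_ratios_equivclp:
  assumes "equivclp affinely_equivalent A B"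
  shows "difference_ratios A = difference_ratios B"
  using assms
proof (induction rule: equivclp_induct)
  case (step B C)
  have "difference_ratios B = difference_ratios C"
    using step.hyps unfolding affinely_equivalent_def by (metis difference_ratios_affine)
  with step.IH show ?case by simp
qed simp

section \<open>Infinitely many classes and the value of \<open>H_star\<close>\<close>

lemma infinite_RSD_classes:
  assumes fin: "finite B" and card: "2 \<le> card B"
    and RSD: "\<And>t. t > N \<Longrightarrow> insert t B \<in> RSD_sets m"
  shows "infinite (RSD_classes m)"
proof
  assume finC: "finite (RSD_classes m)"
  let ?R = "{(A, B). equivclp affinely_equivalent A B}"
  have "(\<lambda>t. ?R `` {insert t B}) ` {N<..} \<subseteq> RSD_classes m"
    using RSD unfolding RSD_classes_def by (intro image_subsetI quotientI) simp
  \<comment> \<open>With finitely many classes, infinitely many \<open>t\<close> fall into the class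
    of a single \<open>insert s B\<close>.\<close>
  then obtain s where s: "infinite {t \<in> {N<..}. ?R `` {insert t B} = ?R `` {insert s B}}"
    using pigeonhole_infinite[OF infinite_Ioi finite_subset[OF _ finC]] by blast
  obtain a b where ab: "a \<in> B" "b \<in> B" "a \<noteq> b"
    using card card_le_Suc0_iff_eq[OF fin] by force
  \<comment> \<open>The ratio \<open>?f t\<close> is injective in \<open>t\<close>, so infinitely
    many such \<open>t\<close> would put infinitely many values into the finite set of ratios of
    \<open>insert s B\<close>.\<close>
  let ?f = "\<lambda>t. real_of_int (t - b) / of_int (a - b)"
  have "?f ` {t \<in> {N<..}. ?R `` {insert t B} = ?R `` {insert s B}} \<subseteq>
      difference_ratios (insert s B)"
  proof (rule image_subsetI)
    fix t assume "t \<in> {t \<in> {N<..}. ?R `` {insert t B} = ?R `` {insert s B}}"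
    then have "?R `` {insert t B} = ?R `` {insert s B}" by blast
    moreover have "insert t B \<in> ?R `` {insert t B}" by simp
    ultimately have "equivclp affinely_equivalent (insert s B) (insert t B)" by blast
    then have "difference_ratios (insert s B) = difference_ratios (insert t B)"
      by (rule difference_ratios_equivclp)
    moreover have "?f t \<in> difference_ratios (insert t B)"
      using ab unfolding difference_ratios_def by blast
    ultimately show "?f t \<in> difference_ratios (insert s B)" by simp
  qed
  moreover have "inj ?f" using ab by (intro injI) simp
  ultimately have "finite {t \<in> {N<..}. ?R `` {insert t B} = ?R `` {insert s B}}"
    using finite_difference_ratios[of "insert s B"] fin
    by (meson finite_imageD finite_insert finite_subset inj_on_subset subset_UNIV)
  with s show False by simp
qed

text \<open>Choosing one representative from each of \<open>j\<close> classes gives a family that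
  the supremum counts, since affine equivalence of two representatives would merge their
  classes.\<close>

lemma H_star_eq_infinity:
  assumes "infinite (RSD_classes m)"
  shows "H_star m = \<infinity>"
proof -
  let ?R = "{(A, B). equivclp affinely_equivalent A B}"
  have "enat j \<le> H_star m" for j
  proof -
    obtain \<C> where \<C>: "finite \<C>" "\<C> \<subseteq> RSD_classes m" "card \<C> = j"
      using infinite_arbitrarily_large[OF assms] by blast
    have "\<forall>C\<in>\<C>. \<exists>X. X \<in> RSD_sets m \<and> C = ?R `` {X}"
      using \<C>(2) unfolding RSD_classes_def quotient_def by blast
    then obtain rep where rep: "\<And>C. C \<in> \<C> \<Longrightarrow> rep C \<in> RSD_sets m \<and> C = ?R `` {rep C}"
      by metis
    have eq: "C = D" if "C \<in> \<C>" "D \<in> \<C>" "equivclp affinely_equivalent (rep C) (rep D)" for C D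
    proof -
      have "?R `` {rep C} = ?R `` {rep D}"
        using that(3) by (auto intro: equivclp_trans equivclp_sym)
      then show ?thesis using rep that by metis
    qed
    have "inj_on rep \<C>" by (rule inj_onI) (simp add: eq)
    then have "card (rep ` \<C>) = j" using \<C>(3) by (simp add: card_image)
    moreover have "pairwise (\<lambda>A B. \<not> affinely_equivalent A B) (rep ` \<C>)"
      using eq by (auto simp: pairwise_def)
    ultimately show ?thesis
      unfolding H_star_def using \<C>(1) rep by (intro Sup_upper) blast
  qed
  \<comment> \<open>With \<open>Suc j\<close>, a finite value \<open>j\<close> of
    \<open>H_star m\<close> is contradicted directly.\<close>
  then have "enat (Suc j) \<le> H_star m" for j by blast
  then show ?thesis by (cases "H_star m") (auto dest: spec simp: not_less_eq_eq[symmetric])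
qed

theorem theorem1:
  fixes k :: nat
  assumes "k > 0"
    and "\<exists>A. RSD A \<and> card A = k"
  shows "\<forall>n\<ge>k. H_star (k ^ n + 1) = \<infinity> \<and> infinite (RSD_classes (k ^ n + 1))"
proof (intro allI impI)
  fix n assume "k \<le> n"
  moreover obtain A where "RSD A" "card A = k" using assms(2) by blast
  ultimately obtain B N
    where "finite B" "2 \<le> card B" "\<forall>t>N. insert t B \<in> RSD_sets (k ^ n + 1)"
    using ex_RSD_insert[of A n] by auto
  then have "infinite (RSD_classes (k ^ n + 1))" by (intro infinite_RSD_classes) auto
  then show "H_star (k ^ n + 1) = \<infinity> \<and> infinite (RSD_classes (k ^ n + 1))"
    using H_star_eq_infinity by blast
qed

end
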